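(* Let $R$ be a finite commutative ring with $1\neq 0$. Then the group $\mathcal{P}_R(R[\alpha])$ is embedded in the semidirect product $\mathcal{P}(R)\ltimes_\theta \mathcal{F}(R)^\times$; that is, there exists an injective group homomorphism $\mathcal{P}_R(R[\alpha])\to \mathcal{P}(R)\ltimes_\theta \mathcal{F}(R)^\times$.
   Context: For a commutative ring $A$ and $f\in A[x]$, $[f]_A\colon A\to A$ denotes the function $a\mapsto f(a)$; functions of this form are the polynomial functions on $A$. For $R$ a finite commutative ring with $1\ne 0$: $\mathcal{F}(R)$ is the set of polynomial functions on $R$, a commutative ring under pointwise addition and multiplication; $\mathcal{F}(R)^\times$ is its group of units (under pointwise multiplication $\cdot$), which consists exactly of the polynomial functions $F$ with $F(r)\in R^\times$ for all $r\in R$. $\mathcal{P}(R)$ is the group, under composition, of bijective polynomial functions on $R$ (polynomial permutations). $R[\alpha]=\{a+b\alpha: a,b\in R\}$ with $\alpha^2=0$ is the ring $R[x]/(x^2)$ of dual numbers over $R$. $\mathcal{P}_R(R[\alpha])$ is the group, under composition, of all bijections of $R[\alpha]$ of the form $[f]_{R[\alpha]}$ with $f\in R[x]$ (coefficients in $R$ only). For $G\in\mathcal{P}(R)$ let $\theta_G$ be the automorphism $F\mapsto F\circ G$ of $\mathcal{F}(R)^\times$. The group $\mathcal{P}(R)\ltimes_\theta\mathcal{F}(R)^\times$ is the set of pairs $(G,F)$ with $G\in\mathcal{P}(R)$, $F\in\mathcal{F}(R)^\times$, with multiplication $(G_1,F_1)(G_2,F_2)=\big(G_1\circ G_2,\ (F_1\circ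 G_2)\cdot F_2\big)$. *)

theory Defs
  imports "HOL-Algebra.Ring" "HOL-Computational_Algebra.Polynomial"
begin

text \<open>
  The ring \<open>R\<close> is the type \<open>'a :: comm_ring_1\<close>; this class includes \<open>0 \<noteq> 1\<close>.
  \<open>Dual a b\<close> stands for \<open>a + b\<alpha>\<close> in \<open>R[\<alpha>] = R[x]/(x^2)\<close>.
\<close>

datatype 'a dual_number = Dual (std_part: 'a) (alpha_part: 'a)

instantiation dual_number :: (comm_ring_1) comm_ring_1
begin

definition "0 = Dual 0 0"
definition "1 = Dual 1 0"
definition "x + y = Dual (std_part x + std_part y) (alpha_part x + alpha_part y)"
definition "x - y = Dual (std_part x - std_part y) (alpha_part x - alpha_part y)"
definition "- x = Dual (- std_part x) (- alpha_part x)"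
definition "x * y = Dual (std_part x * std_part y)
                         (std_part x * alpha_part y + alpha_part x * std_part y)"

instance
  by standard
    (auto simp: zero_dual_number_def one_dual_number_def plus_dual_number_def
      minus_dual_number_def uminus_dual_number_def times_dual_number_def algebra_simps)

end

definition dual_of :: "'a::comm_ring_1 \<Rightarrow> 'a dual_number" where
  "dual_of a = Dual a 0"

definition dual_alpha :: "'a::comm_ring_1 dual_number" where
  "dual_alpha = Dual 0 1"

lemma dual_alpha_squared: "dual_alpha * dual_alpha = (0 :: 'a::comm_ring_1 dual_number)"
  by (simp add: dual_alpha_def times_dual_number_def zero_dual_number_def)

lemma Dual_eq: "Dual a b = dual_of a + dual_of b * dual_alpha"
  by (simp add: dual_of_def dual_alpha_def times_dual_number_def plus_dual_number_def)

definition poly_fun_ring :: "('a::comm_ring_1 \<Rightarrow> 'a) ring" where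
  "poly_fun_ring =
    \<lparr>carrier = range poly,
     monoid.mult = (\<lambda>F G x. F x * G x), monoid.one = (\<lambda>_. 1),
     zero = (\<lambda>_. 0), add = (\<lambda>F G x. F x + G x)\<rparr>"

definition comp_monoid :: "('b \<Rightarrow> 'b) set \<Rightarrow> ('b \<Rightarrow> 'b) monoid" where
  "comp_monoid S = \<lparr>carrier = S, monoid.mult = (\<circ>), monoid.one = id\<rparr>"

definition poly_perm_group :: "('a::comm_ring_1 \<Rightarrow> 'a) monoid" where
  "poly_perm_group = comp_monoid {F \<in> range poly. bij F}"

text \<open>
  The polynomial permutations of \<open>R[\<alpha>]\<close> that are induced by a polynomial with
  coefficients in \<open>R\<close>.
\<close>

definition dual_poly_perm_group :: "('a::comm_ring_1 dual_number \<Rightarrow> 'a dual_number) monoid" where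
  "dual_poly_perm_group =
    comp_monoid {F \<in> range (\<lambda>f :: 'a poly. poly (map_poly dual_of f)). bij F}"

text \<open>
  Semidirect product for a right action: \<open>\<theta> g\<close> is meant to be an automorphism of \<open>H\<close>, with
  \<open>\<theta> (g \<otimes> g') = \<theta> g' \<circ> \<theta> g\<close>.
\<close>

definition semidirect_prod ::
  "('g, 'm) monoid_scheme \<Rightarrow> ('g \<Rightarrow> 'h \<Rightarrow> 'h) \<Rightarrow> ('h, 'n) monoid_scheme \<Rightarrow> ('g \<times> 'h) monoid" where
  "semidirect_prod G \<theta> H =
    \<lparr>carrier = carrier G \<times> carrier H,
     monoid.mult = (\<lambda>(g1, h1) (g2, h2). (g1 \<otimes>\<^bsub>G\<^esub> g2, \<theta> g2 h1 \<otimes>\<^bsub>H\<^esub> h2)),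
     monoid.one = (\<one>\<^bsub>G\<^esub>, \<one>\<^bsub>H\<^esub>)\<rparr>"

definition precomp_action :: "('a \<Rightarrow> 'a) \<Rightarrow> ('a \<Rightarrow> 'a) \<Rightarrow> ('a \<Rightarrow> 'a)" where
  "precomp_action G F = F \<circ> G"

end

theory Submission imports Defs begin

text \<open>
  For \<open>f \<in> R[x]\<close> one has \<open>f(a + b\<alpha>) = f(a) + b f'(a) \<alpha>\<close>, so \<open>f\<close> acts on \<open>R[\<alpha>]\<close> through the
  pair \<open>([f], [f'])\<close>, and the chain rule turns composition into the product of the semidirect
  product. If \<open>f\<close> permutes \<open>R[\<alpha>]\<close>, then \<open>[f]\<close> is onto, and \<open>b f'(a) = 0\<close> forces \<open>b = 0\<close>; since
  \<open>R\<close> is finite, \<open>[f]\<close> is a permutation and multiplication by \<open>[f']\<close> is a bijection of the finite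
  ring of polynomial functions, so that \<open>[f']\<close> is a unit there.
\<close>

subsection \<open>Groups of permutations and semidirect products\<close>

text \<open>Inverses come from finiteness: right composition with \<open>F\<close> is an injective
  self-map of the finite set \<open>S\<close>, hence onto, so \<open>id\<close> is hit and a left
  inverse of \<open>F\<close> lies in \<open>S\<close>.\<close>

lemma group_comp_monoid:
  fixes S :: "('b::finite \<Rightarrow> 'b) set"
  assumes bij: "\<And>F. F \<in> S \<Longrightarrow> bij F"
    and id: "id \<in> S"
    and comp: "\<And>F G. F \<in> S \<Longrightarrow> G \<in> S \<Longrightarrow> F \<circ> G \<in> S"
  shows "group (comp_monoid S)"
proof (rule groupI)
  fix F assume "F \<in> carrier (comp_monoid S)"
  then have F: "F \<in> S" by (simp add: comp_monoid_def)
  have "inj_on (\<lambda>G. G \<circ> F) S"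
  proof (rule inj_onI)
    fix G H assume "G \<circ> F = H \<circ> F"
    then show "G = H"
      using surj_fun_eq[of F UNIV G H] bij[OF F] by (auto simp: bij_def fun_eq_iff)
  qed
  then have "(\<lambda>G. G \<circ> F) ` S = S"
    by (intro endo_inj_surj) (auto simp: comp F)
  then obtain G where "G \<in> S" "G \<circ> F = id"
    using id by (metis (no_types, lifting) imageE)
  then show "\<exists>G\<in>carrier (comp_monoid S). G \<otimes>\<^bsub>comp_monoid S\<^esub> F = \<one>\<^bsub>comp_monoid S\<^esub>"
    by (auto simp: comp_monoid_def)
qed (auto simp: comp_monoid_def comp_assoc id comp)

lemma group_semidirect_prod:
  assumes "group G" "group H"
    and hom: "\<And>g. g \<in> carrier G \<Longrightarrow> \<theta> g \<in> hom H H"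
    and one: "\<And>h. h \<in> carrier H \<Longrightarrow> \<theta> \<one>\<^bsub>G\<^esub> h = h"
    and mult: "\<And>g g' h. g \<in> carrier G \<Longrightarrow> g' \<in> carrier G \<Longrightarrow> h \<in> carrier H
                 \<Longrightarrow> \<theta> (g \<otimes>\<^bsub>G\<^esub> g') h = \<theta> g' (\<theta> g h)"
  shows "group (semidirect_prod G \<theta> H)"
proof -
  interpret G: group G by fact
  interpret H: group H by fact
  have closed: "\<theta> g h \<in> carrier H" if "g \<in> carrier G" "h \<in> carrier H" for g h
    using hom that by (auto simp: hom_def)
  have \<theta>_mult: "\<theta> g (h \<otimes>\<^bsub>H\<^esub> h') = \<theta> g h \<otimes>\<^bsub>H\<^esub> \<theta> g h'"
    if "g \<in> carrier G" "h \<in> carrier H" "h' \<in> carrier H" for g h h'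
    using hom that by (auto simp: hom_def)
  have \<theta>_one: "\<theta> g \<one>\<^bsub>H\<^esub> = \<one>\<^bsub>H\<^esub>" if "g \<in> carrier G" for g
    using hom_one[OF hom[OF that]] H.is_group by blast
  show ?thesis
  proof (rule groupI)
    fix x assume "x \<in> carrier (semidirect_prod G \<theta> H)"
    then obtain g h where x: "x = (g, h)" "g \<in> carrier G" "h \<in> carrier H"
      by (auto simp: semidirect_prod_def)
    \<comment> \<open>By the order reversal in \<open>mult\<close>, the nested action is that of
      \<open>inv g \<otimes> g\<close>, the identity. This makes the pair below a left inverse of
      \<open>(g, h)\<close>.\<close>
    have "\<theta> g (\<theta> (inv\<^bsub>G\<^esub> g) (inv\<^bsub>H\<^esub> h)) = inv\<^bsub>H\<^esub> h"
      using x by (simp flip: mult add: one)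
    then have "(inv\<^bsub>G\<^esub> g, \<theta> (inv\<^bsub>G\<^esub> g) (inv\<^bsub>H\<^esub> h)) \<otimes>\<^bsub>semidirect_prod G \<theta> H\<^esub> x
                 = \<one>\<^bsub>semidirect_prod G \<theta> H\<^esub>"
      using x by (simp add: semidirect_prod_def)
    moreover have "(inv\<^bsub>G\<^esub> g, \<theta> (inv\<^bsub>G\<^esub> g) (inv\<^bsub>H\<^esub> h)) \<in> carrier (semidirect_prod G \<theta> H)"
      using x closed by (simp add: semidirect_prod_def)
    ultimately show "\<exists>y\<in>carrier (semidirect_prod G \<theta> H).
        y \<otimes>\<^bsub>semidirect_prod G \<theta> H\<^esub> x = \<one>\<^bsub>semidirect_prod G \<theta> H\<^esub>"
      by blast
  qed (auto simp: semidirect_prod_def closed \<theta>_mult \<theta>_one mult G.m_assoc H.m_assoc)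
qed

subsection \<open>Polynomial functions\<close>

lemma poly_fun_mult: "F \<in> range poly \<Longrightarrow> G \<in> range poly \<Longrightarrow> (\<lambda>x. F x * G x) \<in> range poly"
  for F :: "'a::comm_ring_1 \<Rightarrow> 'a"
  by (auto simp: image_iff fun_eq_iff) (metis poly_mult)

lemma poly_fun_comp: "F \<in> range poly \<Longrightarrow> G \<in> range poly \<Longrightarrow> F \<circ> G \<in> range poly"
  for F :: "'a::comm_ring_1 \<Rightarrow> 'a"
  by (auto simp: image_iff fun_eq_iff) (metis poly_pcompose)

lemma poly_fun_const: "(\<lambda>_. c) \<in> range poly"
  for c :: "'a::comm_ring_1"
  by (rule range_eqI[where x = "[:c:]"]) auto

lemma poly_fun_id: "id \<in> range (poly :: 'a::comm_ring_1 poly \<Rightarrow> _)"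
  by (rule range_eqI[where x = "[:0, 1:]"]) auto

lemma monoid_poly_fun_ring: "monoid (poly_fun_ring :: ('a::comm_ring_1 \<Rightarrow> 'a) ring)"
  by (rule monoidI) (auto simp: poly_fun_ring_def mult.assoc intro: poly_fun_mult poly_fun_const)

lemma Units_poly_fun_ring:
  "F \<in> Units poly_fun_ring \<longleftrightarrow>
     F \<in> range poly \<and> (\<exists>G \<in> range poly. \<forall>x. F x * G x = 1)"
  for F :: "'a::comm_ring_1 \<Rightarrow> 'a"
  unfolding Units_def poly_fun_ring_def by (auto simp: fun_eq_iff mult.commute)

text \<open>Multiplication by \<open>F\<close> is an injective self-map of the finite set of
  polynomial functions, hence onto. The preimage of the constant 1 is an inverse of \<open>F\<close>
  that is itself polynomial.\<close>

lemma Units_poly_fun_ringI: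
  fixes F :: "'a::{finite, comm_ring_1} \<Rightarrow> 'a"
  assumes F: "F \<in> range poly" and cancel: "\<And>a b. b * F a = 0 \<Longrightarrow> b = 0"
  shows "F \<in> Units poly_fun_ring"
proof -
  have "inj_on (\<lambda>G x. F x * G x) (range poly)"
  proof (intro inj_onI ext)
    fix G H x assume "(\<lambda>x. F x * G x) = (\<lambda>x. F x * H x)"
    then have "(G x - H x) * F x = 0"
      by (simp add: fun_eq_iff algebra_simps)
    then show "G x = H x" using cancel by fastforce
  qed
  then have "(\<lambda>G x. F x * G x) ` range poly = range poly"
    by (intro endo_inj_surj) (auto intro: poly_fun_mult F)
  then obtain G where "G \<in> range poly" "(\<lambda>x. F x * G x) = (\<lambda>_. 1)"
    using poly_fun_const by (metis (no_types, lifting) imageE)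
  with F show ?thesis
    unfolding Units_poly_fun_ring by (metis (no_types, lifting))
qed

text \<open>If \<open>H\<close> is inverse to \<open>F\<close>, then \<open>H \<circ> G\<close> is
  inverse to \<open>F \<circ> G\<close>, and both stay polynomial.\<close>

lemma precomp_action_hom:
  fixes G :: "'a::comm_ring_1 \<Rightarrow> 'a"
  assumes "G \<in> range poly"
  shows "precomp_action G \<in> hom (units_of poly_fun_ring) (units_of poly_fun_ring)"
proof (rule homI)
  fix F :: "'a \<Rightarrow> 'a" assume "F \<in> carrier (units_of poly_fun_ring)"
  then obtain H where "F \<in> range poly" "H \<in> range poly" "\<forall>x. F x * H x = 1"
    by (auto simp: units_of_carrier Units_poly_fun_ring)
  then have "F \<circ> G \<in> range poly" "H \<circ> G \<in> range poly" "\<forall>x. (F \<circ> G) x * (H \<circ> G) x = 1"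
    using assms by (blast intro: poly_fun_comp, blast intro: poly_fun_comp, simp)
  then show "precomp_action G F \<in> carrier (units_of poly_fun_ring)"
    unfolding units_of_carrier Units_poly_fun_ring precomp_action_def by blast
qed (simp add: units_of_mult precomp_action_def poly_fun_ring_def comp_def)

lemma group_poly_perm_group:
  "group (poly_perm_group :: ('a::{finite, comm_ring_1} \<Rightarrow> 'a) monoid)"
  unfolding poly_perm_group_def
  by (rule group_comp_monoid) (auto simp del: image_iff intro: bij_comp poly_fun_comp poly_fun_id)

text \<open>Precomposition is a right action because F \<circ> (G \<circ> G') = (F \<circ> G)
  \<circ> G'.\<close>

lemma group_semidirect_poly_perm_group:
  "group (semidirect_prod (poly_perm_group :: ('a::{finite, comm_ring_1} \<Rightarrow> 'a) monoid)
     precomp_action (units_of poly_fun_ring))"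
proof (rule group_semidirect_prod)
  show "precomp_action g \<in> hom (units_of poly_fun_ring) (units_of poly_fun_ring)"
    if "g \<in> carrier poly_perm_group" for g :: "'a \<Rightarrow> 'a"
    using that by (intro precomp_action_hom) (simp add: poly_perm_group_def comp_monoid_def)
qed (auto simp: poly_perm_group_def comp_monoid_def precomp_action_def
    group_poly_perm_group[unfolded poly_perm_group_def comp_monoid_def]
    monoid.units_group[OF monoid_poly_fun_ring])

subsection \<open>Evaluation at dual numbers\<close>

text \<open>Lets \<open>group_comp_monoid\<close> apply to permutations of R[\<alpha>].\<close>

instance dual_number :: (finite) finite
proof
  have "(UNIV :: 'a dual_number set) = (\<lambda>(a, b). Dual a b) ` UNIV"
    by (auto simp: image_iff) (metis dual_number.exhaust)
  then show "finite (UNIV :: 'a dual_number set)"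
    by (metis finite finite_imageI)
qed

definition dual_eval :: "'a::comm_ring_1 poly \<Rightarrow> 'a dual_number \<Rightarrow> 'a dual_number" where
  "dual_eval f = poly (map_poly dual_of f)"

lemma dual_eval_0 [simp]: "dual_eval 0 x = 0"
  by (simp add: dual_eval_def)

lemma dual_eval_pCons [simp]: "dual_eval (pCons c f) x = dual_of c + x * dual_eval f x"
  by (simp add: dual_eval_def map_poly_pCons dual_of_def zero_dual_number_def)

lemma dual_of_add: "dual_of (a + b) = dual_of a + dual_of b"
  by (simp add: dual_of_def plus_dual_number_def)

lemma dual_of_mult: "dual_of (a * b) = dual_of a * dual_of b"
  by (simp add: dual_of_def times_dual_number_def)

lemma dual_of_0: "dual_of 0 = 0"
  by (simp add: dual_of_def zero_dual_number_def)

lemma dual_eval_add: "dual_eval (f + g) x = dual_eval f x + dual_eval g x"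
  by (induction f g rule: poly_induct2) (simp_all add: dual_of_add algebra_simps)

lemma dual_eval_smult: "dual_eval (smult c f) x = dual_of c * dual_eval f x"
  by (induction f) (simp_all add: dual_of_mult algebra_simps)

lemma dual_eval_mult: "dual_eval (f * g) x = dual_eval f x * dual_eval g x"
  by (induction f) (simp_all add: dual_eval_add dual_eval_smult dual_of_0 algebra_simps)

text \<open>Gives closure under composition: the composite of two induced maps is again induced by a
  polynomial over R.\<close>

lemma dual_eval_pcompose: "dual_eval (pcompose f g) x = dual_eval f (dual_eval g x)"
  by (induction f) (simp_all add: pcompose_pCons dual_eval_add dual_eval_mult)

text \<open>
  The polynomial \<open>g\<close> is the formal derivative of \<open>f\<close>; the library's \<open>pderiv\<close> is not available
  because it requires the absence of zero divisors.
\<close>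

lemma dual_eval_Dual:
  "\<exists>g. \<forall>a b. dual_eval f (Dual a b) = Dual (poly f a) (b * poly g a)"
proof (induction f)
  case 0
  then show ?case by (auto simp: zero_dual_number_def intro!: exI[of _ 0])
next
  case (pCons c f)
  then obtain g where "\<forall>a b. dual_eval f (Dual a b) = Dual (poly f a) (b * poly g a)"
    by blast
  then show ?case
    \<comment> \<open>The product rule: (c + x f)' = f + x f'.\<close>
    by (intro exI[of _ "f + pCons 0 g"])
      (simp add: dual_of_def plus_dual_number_def times_dual_number_def algebra_simps)
qed

lemma dual_poly_permE:
  assumes "F \<in> carrier dual_poly_perm_group"
  obtains f g where "F = dual_eval f" "bij F"
    "\<And>a b. F (Dual a b) = Dual (poly f a) (b * poly g a)"
  using assms dual_eval_Dual
  by (fastforce simp: dual_poly_perm_group_def comp_monoid_def simp flip: dual_eval_def)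

lemma group_dual_poly_perm_group:
  "group (dual_poly_perm_group :: ('a::{finite, comm_ring_1} dual_number \<Rightarrow> _) monoid)"
  unfolding dual_poly_perm_group_def
proof (rule group_comp_monoid; unfold dual_eval_def[symmetric])
  have "id = dual_eval [:0, 1 :: 'a:]"
    by (auto simp: dual_of_def zero_dual_number_def one_dual_number_def plus_dual_number_def
        times_dual_number_def)
  then show "id \<in> {F \<in> range (dual_eval :: 'a poly \<Rightarrow> _). bij F}" by auto
next
  fix F G :: "'a dual_number \<Rightarrow> 'a dual_number"
  assume FG: "F \<in> {F \<in> range dual_eval. bij F}" "G \<in> {F \<in> range dual_eval. bij F}"
  then obtain f g where "F = dual_eval f" "G = dual_eval g" by auto
  then have "F \<circ> G = dual_eval (pcompose f g)"
    by (auto simp: dual_eval_pcompose)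
  moreover have "bij (F \<circ> G)" using FG by (auto intro: bij_comp)
  ultimately show "F \<circ> G \<in> {F \<in> range dual_eval. bij F}" by blast
qed auto

subsection \<open>The embedding\<close>

text \<open>Reads off [f] at the points a and [f'] at the points a + \<alpha>. Being defined from
  the function alone, it does not depend on the choice of a polynomial inducing it.\<close>

definition dual_embed ::
  "('a::comm_ring_1 dual_number \<Rightarrow> 'a dual_number) \<Rightarrow> ('a \<Rightarrow> 'a) \<times> ('a \<Rightarrow> 'a)" where
  "dual_embed F = (\<lambda>a. std_part (F (Dual a 0)), \<lambda>a. alpha_part (F (Dual a 1)))"

lemma dual_embed_eq:
  assumes "\<And>a b. F (Dual a b) = Dual (poly f a) (b * poly g a)"
  shows "dual_embed F = (poly f, poly g)"
  using assms by (simp add: dual_embed_def)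

lemma dual_embed_closed:
  fixes F :: "'a::{finite, comm_ring_1} dual_number \<Rightarrow> 'a dual_number"
  assumes "F \<in> carrier dual_poly_perm_group"
  shows "dual_embed F \<in>
    carrier (semidirect_prod poly_perm_group precomp_action (units_of poly_fun_ring))"
proof -
  obtain f g where "bij F" and F: "\<And>a b. F (Dual a b) = Dual (poly f a) (b * poly g a)"
    using assms by (rule dual_poly_permE) blast
  have "surj (poly f)"
  proof (unfold surj_def, rule allI)
    fix c
    \<comment> \<open>The standard part of a preimage of c under \<open>F\<close> is a preimage of c
      under [f].\<close>
    obtain x where x: "F x = Dual c 0"
      using \<open>bij F\<close> by (metis bij_pointE)
    then show "\<exists>a. c = poly f a"
      using F[of "std_part x" "alpha_part x"] by auto
  qed
  then have "bij (poly f)"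
    by (simp add: bij_def finite_UNIV_surj_inj)
  moreover have "poly g \<in> Units poly_fun_ring"
  proof (rule Units_poly_fun_ringI)
    fix a b assume "b * poly g a = 0"
    \<comment> \<open>If b annihilates the value of \<open>poly g\<close> at a, then a + b\<alpha>
      and a have the same image, so injectivity gives b = 0.\<close>
    then have "F (Dual a b) = F (Dual a 0)" by (simp add: F)
    then show "b = 0" using \<open>bij F\<close> by (auto dest: bij_is_inj injD)
  qed auto
  ultimately show ?thesis
    by (simp add: dual_embed_eq[OF F] semidirect_prod_def poly_perm_group_def comp_monoid_def
        units_of_carrier)
qed

text \<open>The chain rule: \<open>G\<close> sends a + \<alpha> to g(a) + g'(a)\<alpha>, which
  \<open>F\<close> sends to f(g(a)) + g'(a) f'(g(a))\<alpha>.\<close>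

lemma dual_embed_comp:
  assumes "F \<in> carrier dual_poly_perm_group" "G \<in> carrier dual_poly_perm_group"
  shows "dual_embed (F \<circ> G) =
    dual_embed F \<otimes>\<^bsub>semidirect_prod poly_perm_group precomp_action (units_of poly_fun_ring)\<^esub>
    dual_embed G"
proof -
  obtain f f' where F: "\<And>a b. F (Dual a b) = Dual (poly f a) (b * poly f' a)"
    using assms(1) by (rule dual_poly_permE) blast
  obtain g g' where G: "\<And>a b. G (Dual a b) = Dual (poly g a) (b * poly g' a)"
    using assms(2) by (rule dual_poly_permE) blast
  show ?thesis
    by (simp add: dual_embed_def F G semidirect_prod_def poly_perm_group_def comp_monoid_def
        precomp_action_def units_of_mult poly_fun_ring_def fun_eq_iff mult.commute)
qed

text \<open>The pair of functions determines the image of every a + b\<alpha>, not only of the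
  sampled points with b = 0 or b = 1.\<close>

lemma inj_on_dual_embed: "inj_on dual_embed (carrier dual_poly_perm_group)"
proof (intro inj_onI ext)
  fix F G :: "'a dual_number \<Rightarrow> 'a dual_number" and x
  assume FG: "F \<in> carrier dual_poly_perm_group" "G \<in> carrier dual_poly_perm_group"
    and eq: "dual_embed F = dual_embed G"
  obtain f f' where F: "\<And>a b. F (Dual a b) = Dual (poly f a) (b * poly f' a)"
    using FG(1) by (rule dual_poly_permE) blast
  obtain g g' where G: "\<And>a b. G (Dual a b) = Dual (poly g a) (b * poly g' a)"
    using FG(2) by (rule dual_poly_permE) blast
  show "F x = G x"
    using eq by (cases x) (simp add: dual_embed_eq[OF F] dual_embed_eq[OF G] F G)
qed

theorem proposition3p9:
  "\<exists>\<phi>. group_hom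
         (dual_poly_perm_group ::
            ('a::{finite, comm_ring_1} dual_number \<Rightarrow> 'a dual_number) monoid)
         (semidirect_prod
            (poly_perm_group :: ('a \<Rightarrow> 'a) monoid)
            precomp_action
            (units_of (poly_fun_ring :: ('a \<Rightarrow> 'a) ring)))
         \<phi> \<and>
       inj_on \<phi> (carrier
         (dual_poly_perm_group :: ('a dual_number \<Rightarrow> 'a dual_number) monoid))"
proof (intro exI conjI)
  let ?D = "dual_poly_perm_group :: ('a dual_number \<Rightarrow> 'a dual_number) monoid"
  let ?S = "semidirect_prod (poly_perm_group :: ('a \<Rightarrow> 'a) monoid) precomp_action
    (units_of poly_fun_ring)"
  have "dual_embed \<in> hom ?D ?S"
  proof (rule homI)
    fix F G assume "F \<in> carrier ?D" "G \<in> carrier ?D"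
    moreover have "F \<otimes>\<^bsub>?D\<^esub> G = F \<circ> G"
      by (simp add: dual_poly_perm_group_def comp_monoid_def)
    ultimately show "dual_embed (F \<otimes>\<^bsub>?D\<^esub> G) = dual_embed F \<otimes>\<^bsub>?S\<^esub> dual_embed G"
      by (simp add: dual_embed_comp)
  qed (rule dual_embed_closed)
  then show "group_hom ?D ?S dual_embed"
    by (simp add: group_hom_def group_hom_axioms_def group_dual_poly_perm_group
        group_semidirect_poly_perm_group)
qed (rule inj_on_dual_embed)

end
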